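(* Let $M$ be a smooth manifold with a bivector field $\pi$, a vector field $\xi$ and a pseudo-Riemannian metric $g$. Suppose that the skew algebroid $(T^*M,\sharp_{\pi,\xi},[\cdot,\cdot]_{\pi,\xi}^{g})$ is a pre-Lie algebroid and that the anchor $\sharp_{\pi,\xi}$ is an isometry. Then $$\sharp_{\pi,\xi}(\mathcal{D}_\alpha\beta)=\nabla_{\sharp_{\pi,\xi}(\alpha)}\sharp_{\pi,\xi}(\beta)\qquad\text{for all }\alpha,\beta\in\Omega^1(M),$$ where $\nabla$ is the (covariant) Levi-Civita connection of $g$ and $\mathcal{D}$ is the contravariant Levi-Civita derivative associated with $(\pi,\xi,g)$.
   Context: Define $\sharp_\pi:T^*M\to TM$ by $\beta(\sharp_\pi(\alpha))=\pi(\alpha,\beta)$; $[\alpha,\beta]_\pi=\mathcal{L}_{\sharp_\pi(\alpha)}\beta-\mathcal{L}_{\sharp_\pi(\beta)}\alpha-d(\pi(\alpha,\beta))$; $\sharp_{\pi,\xi}(\alpha)=\sharp_\pi(\alpha)+\alpha(\xi)\xi$; and, for $\lambda\in\Omega^1(M)$, $$[\alpha,\beta]_{\pi,\xi}^{\lambda}=[\alpha,\beta]_\pi+\alpha(\xi)(\mathcal{L}_\xi\beta-\beta)-\beta(\xi)(\mathcal{L}_\xi\alpha-\alpha)-\pi(\alpha,\beta)\lambda .$$ Let $\flat_g:TM\to T^*M$, $\flat_g(X)(Y)=g(X,Y)$, $\sharp_g=\flat_g^{-1}$, $g^*(\alpha,\beta)=g(\sharp_g(\alpha),\sharp_g(\beta))$.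 Let $J:TM\to TM$ be defined by $g(J\sharp_g(\alpha),\sharp_g(\beta))=\pi(\alpha,\beta)$. Put $\lambda=g(\xi,\xi)\flat_g(\xi)-\flat_g(J\xi)$ and $[\cdot,\cdot]_{\pi,\xi}^{g}:=[\cdot,\cdot]_{\pi,\xi}^{\lambda}$ for this $\lambda$. The triple $(T^*M,\sharp_{\pi,\xi},[\cdot,\cdot]_{\pi,\xi}^{g})$ is a skew algebroid (skew bracket on $\Omega^1(M)$ satisfying the Leibniz rule with anchor $\sharp_{\pi,\xi}$); it is a pre-Lie algebroid if $\sharp_{\pi,\xi}([\alpha,\beta]_{\pi,\xi}^{g})=[\sharp_{\pi,\xi}(\alpha),\sharp_{\pi,\xi}(\beta)]$ for all $\alpha,\beta\in\Omega^1(M)$. The map $\sharp_{\pi,\xi}$ is an isometry if $g(\sharp_{\pi,\xi}(\alpha),\sharp_{\pi,\xi}(\beta))=g^*(\alpha,\beta)$ for all $\alpha,\beta$. The contravariant Levi-Civita derivative of $(\pi,\xi,g)$ is the unique contravariant derivative $\mathcal{D}:\Omega^1(M)\times\Omega^1(M)\to\Omega^1(M)$ ($\mathbb{R}$-bilinear, $\mathcal{D}_{\varphi\alpha}\beta=\varphi\mathcal{D}_\alpha\beta$, $\mathcal{D}_\alpha(\varphi\beta)=\varphi\mathcal{D}_\alpha\beta+\sharp_{\pi,\xi}(\alpha)(\varphi)\beta$) satisfying $\mathcal{D}_\alpha\beta-\mathcal{D}_\beta\alpha=[\alpha,\beta]_{\pi,\xi}^{g}$ and $\sharp_{\pi,\xi}(\alpha)\cdot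 g^*(\beta,\gamma)=g^*(\mathcal{D}_\alpha\beta,\gamma)+g^*(\beta,\mathcal{D}_\alpha\gamma)$. *)

theory Defs
  imports "HOL-Analysis.Analysis" "HOL-Library.Function_Algebras"
begin

section \<open>Pointwise real vector space structure on functions\<close>

text \<open>Tangent vectors, covectors, fields and forms are all functions below; with this
  instance \<open>+\<close>, \<open>-\<close> and \<open>*\<^sub>R\<close> are the usual pointwise operations on them.\<close>

instantiation "fun" :: (type, real_vector) real_vector
begin

definition scaleR_fun :: "real \<Rightarrow> ('a \<Rightarrow> 'b) \<Rightarrow> 'a \<Rightarrow> 'b"
  where "scaleR_fun c f = (\<lambda>x. c *\<^sub>R f x)"

instance
  by standard (simp_all add: scaleR_fun_def fun_eq_iff scaleR_add_right scaleR_add_left)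

end

definition lin_on :: "'v::real_vector set \<Rightarrow> ('v \<Rightarrow> real) \<Rightarrow> bool"
  where "lin_on V a \<longleftrightarrow>
    (\<forall>u\<in>V. \<forall>v\<in>V. a (u + v) = a u + a v) \<and> (\<forall>c. \<forall>v\<in>V. a (c *\<^sub>R v) = c * a v)"

definition bilin_on :: "'v::real_vector set \<Rightarrow> ('v \<Rightarrow> 'v \<Rightarrow> real) \<Rightarrow> bool"
  where "bilin_on V b \<longleftrightarrow> (\<forall>u\<in>V. lin_on V (b u)) \<and> (\<forall>v\<in>V. lin_on V (\<lambda>u. b u v))"


section \<open>Smooth manifolds\<close>

text \<open>On an open subset \<open>S\<close> of a finite-dimensional space this says that \<open>f\<close> is of
  class \<open>C^k\<close>.\<close>

primrec Ck_on :: "nat \<Rightarrow> ('a::real_normed_vector \<Rightarrow> 'b::real_normed_vector) \<Rightarrow> 'a set \<Rightarrow> bool"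
  where
    "Ck_on 0 f S \<longleftrightarrow> continuous_on S f"
  | "Ck_on (Suc k) f S \<longleftrightarrow>
      (\<forall>x\<in>S. f differentiable at x) \<and> (\<forall>v. Ck_on k (\<lambda>x. frechet_derivative f (at x) v) S)"

definition smooth_on :: "'a set \<Rightarrow> ('a::real_normed_vector \<Rightarrow> 'b::real_normed_vector) \<Rightarrow> bool"
  where "smooth_on S f \<longleftrightarrow> (\<forall>k. Ck_on k f S)"

text \<open>A chart is a pair \<open>(U, \<phi>)\<close>; its inverse is \<open>inv_into U \<phi>\<close>. The manifold is the whole
  type \<open>'m\<close>, and the model space is an arbitrary finite-dimensional normed space \<open>'e\<close>. (The
  class \<open>euclidean_space\<close> would rule out manifolds of dimension 0.)\<close>

type_synonym ('m, 'e) chart = "'m set \<times> ('m \<Rightarrow> 'e)"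

definition smooth_manifold ::
  "('m::{t2_space, second_countable_topology}, 'e::real_normed_vector) chart set \<Rightarrow> bool"
  where "smooth_manifold A \<longleftrightarrow>
    (\<exists>B::'e set. finite B \<and> span B = UNIV) \<and>
    (\<Union>(U, \<phi>)\<in>A. U) = UNIV \<and>
    (\<forall>(U, \<phi>)\<in>A. open U \<and> open (\<phi> ` U) \<and> homeomorphism U (\<phi> ` U) \<phi> (inv_into U \<phi>)) \<and>
    (\<forall>(U, \<phi>)\<in>A. \<forall>(V, \<psi>)\<in>A. smooth_on (\<phi> ` (U \<inter> V)) (\<psi> \<circ> inv_into U \<phi>))"

definition smooth_funs ::
  "('m::{t2_space, second_countable_topology}, 'e::real_normed_vector) chart set \<Rightarrow> ('m \<Rightarrow> real) set"
  where "smooth_funs A = {f. \<forall>(U, \<phi>)\<in>A. smooth_on (\<phi> ` U) (f \<circ> inv_into U \<phi>)}"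


section \<open>Tangent vectors, vector fields and one-forms\<close>

text \<open>A tangent vector at \<open>p\<close> is a directional derivative operator on smooth functions:
  in some chart \<open>\<phi>\<close> around \<open>p\<close> it is the derivative of \<open>f \<circ> \<phi>\<^sup>-\<^sup>1\<close> at \<open>\<phi> p\<close> in a direction
  \<open>w\<close>, i.e. the sum of the \<open>w\<^sub>i \<partial>/\<partial>x\<^sub>i\<close>. Tangent vectors are set to 0 on
  nonsmooth functions and covectors to 0 off the tangent space, so that equality of vectors,
  covectors, fields and forms is equality in HOL.\<close>

type_synonym 'm tvec = "('m \<Rightarrow> real) \<Rightarrow> real"
type_synonym 'm covec = "'m tvec \<Rightarrow> real"

definition tangent_space ::
  "('m::{t2_space, second_countable_topology}, 'e::real_normed_vector) chart set \<Rightarrow> 'm \<Rightarrow> 'm tvec set"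
  where "tangent_space A p = {v. \<exists>(U, \<phi>)\<in>A. p \<in> U \<and> (\<exists>w.
    v = (\<lambda>f. if f \<in> smooth_funs A
             then frechet_derivative (f \<circ> inv_into U \<phi>) (at (\<phi> p)) w else 0))}"

definition cotangent_space ::
  "('m::{t2_space, second_countable_topology}, 'e::real_normed_vector) chart set \<Rightarrow> 'm \<Rightarrow> 'm covec set"
  where "cotangent_space A p =
    {a. lin_on (tangent_space A p) a \<and> (\<forall>v. v \<notin> tangent_space A p \<longrightarrow> a v = 0)}"

text \<open>Fibrewise application: with it \<open>\<alpha> \<odot> X\<close> is the function \<open>\<alpha>(X)\<close>, \<open>\<pi> \<odot> \<alpha> \<odot> \<beta>\<close> is the
  function \<open>\<pi>(\<alpha>, \<beta>)\<close>, and \<open>F \<odot> s\<close> is the image of a section \<open>s\<close> under a bundle map \<open>F\<close>.\<close>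

definition fibre_app :: "('m \<Rightarrow> 'x \<Rightarrow> 'y) \<Rightarrow> ('m \<Rightarrow> 'x) \<Rightarrow> 'm \<Rightarrow> 'y"  (infixl \<open>\<odot>\<close> 90)
  where "F \<odot> s = (\<lambda>p. F p (s p))"

definition fun_scale :: "('m \<Rightarrow> real) \<Rightarrow> ('m \<Rightarrow> 'x::real_vector) \<Rightarrow> 'm \<Rightarrow> 'x"  (infixr \<open>*\<^sub>C\<close> 75)
  where "\<phi> *\<^sub>C s = (\<lambda>p. \<phi> p *\<^sub>R s p)"

definition dir_deriv :: "('m \<Rightarrow> 'm tvec) \<Rightarrow> ('m \<Rightarrow> real) \<Rightarrow> 'm \<Rightarrow> real"
  where "dir_deriv X f = (\<lambda>p. X p f)"

text \<open>Smoothness of fields, forms and tensors is tested on smooth functions, fields and forms;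
  this is equivalent to smoothness of the components in charts.\<close>

definition vector_fields ::
  "('m::{t2_space, second_countable_topology}, 'e::real_normed_vector) chart set \<Rightarrow> ('m \<Rightarrow> 'm tvec) set"
  where "vector_fields A =
    {X. (\<forall>p. X p \<in> tangent_space A p) \<and> (\<forall>f\<in>smooth_funs A. dir_deriv X f \<in> smooth_funs A)}"

definition one_forms ::
  "('m::{t2_space, second_countable_topology}, 'e::real_normed_vector) chart set \<Rightarrow> ('m \<Rightarrow> 'm covec) set"
  where "one_forms A =
    {\<alpha>. (\<forall>p. \<alpha> p \<in> cotangent_space A p) \<and> (\<forall>X\<in>vector_fields A. \<alpha> \<odot> X \<in> smooth_funs A)}"

definition bivector_field ::
  "('m::{t2_space, second_countable_topology}, 'e::real_normed_vector) chart set \<Rightarrow>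
   ('m \<Rightarrow> 'm covec \<Rightarrow> 'm covec \<Rightarrow> real) \<Rightarrow> bool"
  where "bivector_field A \<pi> \<longleftrightarrow>
    (\<forall>p. bilin_on (cotangent_space A p) (\<pi> p) \<and>
         (\<forall>a\<in>cotangent_space A p. \<forall>b\<in>cotangent_space A p. \<pi> p a b = - \<pi> p b a)) \<and>
    (\<forall>\<alpha>\<in>one_forms A. \<forall>\<beta>\<in>one_forms A. \<pi> \<odot> \<alpha> \<odot> \<beta> \<in> smooth_funs A)"

definition pseudo_riemannian_metric ::
  "('m::{t2_space, second_countable_topology}, 'e::real_normed_vector) chart set \<Rightarrow>
   ('m \<Rightarrow> 'm tvec \<Rightarrow> 'm tvec \<Rightarrow> real) \<Rightarrow> bool"
  where "pseudo_riemannian_metric A g \<longleftrightarrow>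
    (\<forall>p. bilin_on (tangent_space A p) (g p) \<and>
         (\<forall>v\<in>tangent_space A p. \<forall>w\<in>tangent_space A p. g p v w = g p w v) \<and>
         (\<forall>v\<in>tangent_space A p. (\<forall>w\<in>tangent_space A p. g p v w = 0) \<longrightarrow> v = 0)) \<and>
    (\<forall>X\<in>vector_fields A. \<forall>Y\<in>vector_fields A. g \<odot> X \<odot> Y \<in> smooth_funs A)"


section \<open>Differential, Lie bracket and Lie derivative\<close>

definition differential ::
  "('m::{t2_space, second_countable_topology}, 'e::real_normed_vector) chart set \<Rightarrow>
   ('m \<Rightarrow> real) \<Rightarrow> 'm \<Rightarrow> 'm covec"
  where "differential A f = (\<lambda>p v. if v \<in> tangent_space A p then v f else 0)"

definition lie_bracket ::
  "('m::{t2_space, second_countable_topology}, 'e::real_normed_vector) chart set \<Rightarrow>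
   ('m \<Rightarrow> 'm tvec) \<Rightarrow> ('m \<Rightarrow> 'm tvec) \<Rightarrow> 'm \<Rightarrow> 'm tvec"
  where "lie_bracket A X Y = (\<lambda>p f. if f \<in> smooth_funs A
    then dir_deriv X (dir_deriv Y f) p - dir_deriv Y (dir_deriv X f) p else 0)"

text \<open>The right-hand side of the characterizing equation is tensorial in \<open>Y\<close> and every tangent
  vector extends to a vector field, so the one-form exists and is unique.\<close>

definition lie_deriv ::
  "('m::{t2_space, second_countable_topology}, 'e::real_normed_vector) chart set \<Rightarrow>
   ('m \<Rightarrow> 'm tvec) \<Rightarrow> ('m \<Rightarrow> 'm covec) \<Rightarrow> 'm \<Rightarrow> 'm covec"
  where "lie_deriv A X \<beta> = (THE \<gamma>. \<gamma> \<in> one_forms A \<and>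
    (\<forall>Y\<in>vector_fields A. \<gamma> \<odot> Y = dir_deriv X (\<beta> \<odot> Y) - \<beta> \<odot> lie_bracket A X Y))"


section \<open>Bundle maps associated with a bivector field and a metric\<close>

definition sharp_pi ::
  "('m::{t2_space, second_countable_topology}, 'e::real_normed_vector) chart set \<Rightarrow>
   ('m \<Rightarrow> 'm covec \<Rightarrow> 'm covec \<Rightarrow> real) \<Rightarrow> 'm \<Rightarrow> 'm covec \<Rightarrow> 'm tvec"
  where "sharp_pi A \<pi> p a =
    (THE v. v \<in> tangent_space A p \<and> (\<forall>b\<in>cotangent_space A p. b v = \<pi> p a b))"

definition anchor ::
  "('m::{t2_space, second_countable_topology}, 'e::real_normed_vector) chart set \<Rightarrow>
   ('m \<Rightarrow> 'm covec \<Rightarrow> 'm covec \<Rightarrow> real) \<Rightarrow> ('m \<Rightarrow> 'm tvec) \<Rightarrow> 'm \<Rightarrow> 'm covec \<Rightarrow> 'm tvec"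
  where "anchor A \<pi> \<xi> p a = sharp_pi A \<pi> p a + a (\<xi> p) *\<^sub>R \<xi> p"

definition flat ::
  "('m::{t2_space, second_countable_topology}, 'e::real_normed_vector) chart set \<Rightarrow>
   ('m \<Rightarrow> 'm tvec \<Rightarrow> 'm tvec \<Rightarrow> real) \<Rightarrow> 'm \<Rightarrow> 'm tvec \<Rightarrow> 'm covec"
  where "flat A g p v = (\<lambda>w. if w \<in> tangent_space A p then g p v w else 0)"

definition sharp_g ::
  "('m::{t2_space, second_countable_topology}, 'e::real_normed_vector) chart set \<Rightarrow>
   ('m \<Rightarrow> 'm tvec \<Rightarrow> 'm tvec \<Rightarrow> real) \<Rightarrow> 'm \<Rightarrow> 'm covec \<Rightarrow> 'm tvec"
  where "sharp_g A g p = the_inv_into (tangent_space A p) (flat A g p)"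

definition cometric ::
  "('m::{t2_space, second_countable_topology}, 'e::real_normed_vector) chart set \<Rightarrow>
   ('m \<Rightarrow> 'm tvec \<Rightarrow> 'm tvec \<Rightarrow> real) \<Rightarrow> 'm \<Rightarrow> 'm covec \<Rightarrow> 'm covec \<Rightarrow> real"
  where "cometric A g p a b = g p (sharp_g A g p a) (sharp_g A g p b)"

definition J_endo ::
  "('m::{t2_space, second_countable_topology}, 'e::real_normed_vector) chart set \<Rightarrow>
   ('m \<Rightarrow> 'm covec \<Rightarrow> 'm covec \<Rightarrow> real) \<Rightarrow> ('m \<Rightarrow> 'm tvec \<Rightarrow> 'm tvec \<Rightarrow> real) \<Rightarrow>
   'm \<Rightarrow> 'm tvec \<Rightarrow> 'm tvec"
  where "J_endo A \<pi> g p v = (THE u. u \<in> tangent_space A p \<and>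
    (\<forall>a\<in>cotangent_space A p. \<forall>b\<in>cotangent_space A p.
       v = sharp_g A g p a \<longrightarrow> g p u (sharp_g A g p b) = \<pi> p a b))"


section \<open>The skew algebroid bracket\<close>

definition bracket_pi ::
  "('m::{t2_space, second_countable_topology}, 'e::real_normed_vector) chart set \<Rightarrow>
   ('m \<Rightarrow> 'm covec \<Rightarrow> 'm covec \<Rightarrow> real) \<Rightarrow>
   ('m \<Rightarrow> 'm covec) \<Rightarrow> ('m \<Rightarrow> 'm covec) \<Rightarrow> 'm \<Rightarrow> 'm covec"
  where "bracket_pi A \<pi> \<alpha> \<beta> =
    lie_deriv A (sharp_pi A \<pi> \<odot> \<alpha>) \<beta> - lie_deriv A (sharp_pi A \<pi> \<odot> \<beta>) \<alpha>
    - differential A (\<pi> \<odot> \<alpha> \<odot> \<beta>)"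

definition bracket_lambda ::
  "('m::{t2_space, second_countable_topology}, 'e::real_normed_vector) chart set \<Rightarrow>
   ('m \<Rightarrow> 'm covec \<Rightarrow> 'm covec \<Rightarrow> real) \<Rightarrow> ('m \<Rightarrow> 'm tvec) \<Rightarrow> ('m \<Rightarrow> 'm covec) \<Rightarrow>
   ('m \<Rightarrow> 'm covec) \<Rightarrow> ('m \<Rightarrow> 'm covec) \<Rightarrow> 'm \<Rightarrow> 'm covec"
  where "bracket_lambda A \<pi> \<xi> \<mu> \<alpha> \<beta> =
    bracket_pi A \<pi> \<alpha> \<beta>
    + (\<alpha> \<odot> \<xi>) *\<^sub>C (lie_deriv A \<xi> \<beta> - \<beta>)
    - (\<beta> \<odot> \<xi>) *\<^sub>C (lie_deriv A \<xi> \<alpha> - \<alpha>)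
    - (\<pi> \<odot> \<alpha> \<odot> \<beta>) *\<^sub>C \<mu>"

definition lambda_g ::
  "('m::{t2_space, second_countable_topology}, 'e::real_normed_vector) chart set \<Rightarrow>
   ('m \<Rightarrow> 'm covec \<Rightarrow> 'm covec \<Rightarrow> real) \<Rightarrow> ('m \<Rightarrow> 'm tvec) \<Rightarrow>
   ('m \<Rightarrow> 'm tvec \<Rightarrow> 'm tvec \<Rightarrow> real) \<Rightarrow> 'm \<Rightarrow> 'm covec"
  where "lambda_g A \<pi> \<xi> g =
    (g \<odot> \<xi> \<odot> \<xi>) *\<^sub>C (flat A g \<odot> \<xi>) - flat A g \<odot> (J_endo A \<pi> g \<odot> \<xi>)"

definition bracket_g ::
  "('m::{t2_space, second_countable_topology}, 'e::real_normed_vector) chart set \<Rightarrow>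
   ('m \<Rightarrow> 'm covec \<Rightarrow> 'm covec \<Rightarrow> real) \<Rightarrow> ('m \<Rightarrow> 'm tvec) \<Rightarrow>
   ('m \<Rightarrow> 'm tvec \<Rightarrow> 'm tvec \<Rightarrow> real) \<Rightarrow>
   ('m \<Rightarrow> 'm covec) \<Rightarrow> ('m \<Rightarrow> 'm covec) \<Rightarrow> 'm \<Rightarrow> 'm covec"
  where "bracket_g A \<pi> \<xi> g = bracket_lambda A \<pi> \<xi> (lambda_g A \<pi> \<xi> g)"

text \<open>The condition that turns a skew algebroid \<open>(T\<^sup>*M, \<rho>, br)\<close> into a pre-Lie algebroid. That
  \<open>bracket_g A \<pi> \<xi> g\<close> with \<open>anchor A \<pi> \<xi>\<close> is a skew algebroid holds without assumptions.\<close>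

definition pre_lie_algebroid ::
  "('m::{t2_space, second_countable_topology}, 'e::real_normed_vector) chart set \<Rightarrow>
   ('m \<Rightarrow> 'm covec \<Rightarrow> 'm tvec) \<Rightarrow>
   (('m \<Rightarrow> 'm covec) \<Rightarrow> ('m \<Rightarrow> 'm covec) \<Rightarrow> 'm \<Rightarrow> 'm covec) \<Rightarrow> bool"
  where "pre_lie_algebroid A \<rho> br \<longleftrightarrow>
    (\<forall>\<alpha>\<in>one_forms A. \<forall>\<beta>\<in>one_forms A. \<rho> \<odot> br \<alpha> \<beta> = lie_bracket A (\<rho> \<odot> \<alpha>) (\<rho> \<odot> \<beta>))"

definition isometric_anchor ::
  "('m::{t2_space, second_countable_topology}, 'e::real_normed_vector) chart set \<Rightarrow>
   ('m \<Rightarrow> 'm covec \<Rightarrow> 'm tvec) \<Rightarrow> ('m \<Rightarrow> 'm tvec \<Rightarrow> 'm tvec \<Rightarrow> real) \<Rightarrow> bool"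
  where "isometric_anchor A \<rho> g \<longleftrightarrow>
    (\<forall>\<alpha>\<in>one_forms A. \<forall>\<beta>\<in>one_forms A. g \<odot> (\<rho> \<odot> \<alpha>) \<odot> (\<rho> \<odot> \<beta>) = cometric A g \<odot> \<alpha> \<odot> \<beta>)"


section \<open>Levi-Civita derivatives\<close>

text \<open>A derivative along the sections in \<open>S\<close> of an anchored bundle; \<open>\<rho>\<close> sends sections to vector
  fields. Covariant derivatives of vector fields and contravariant derivatives of one-forms
  are the two instances.\<close>

definition derivative_on ::
  "('m::{t2_space, second_countable_topology}, 'e::real_normed_vector) chart set \<Rightarrow>
   ('m \<Rightarrow> 'x::real_vector) set \<Rightarrow> (('m \<Rightarrow> 'x) \<Rightarrow> 'm \<Rightarrow> 'm tvec) \<Rightarrow>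
   (('m \<Rightarrow> 'x) \<Rightarrow> ('m \<Rightarrow> 'x) \<Rightarrow> 'm \<Rightarrow> 'x) \<Rightarrow> bool"
  where "derivative_on A S \<rho> D \<longleftrightarrow>
    (\<forall>s\<in>S. \<forall>t\<in>S. D s t \<in> S) \<and>
    (\<forall>s\<in>S. \<forall>s'\<in>S. \<forall>t\<in>S. D (s + s') t = D s t + D s' t) \<and>
    (\<forall>s\<in>S. \<forall>t\<in>S. \<forall>t'\<in>S. D s (t + t') = D s t + D s t') \<and>
    (\<forall>c::real. \<forall>s\<in>S. \<forall>t\<in>S. D (c *\<^sub>R s) t = c *\<^sub>R D s t \<and> D s (c *\<^sub>R t) = c *\<^sub>R D s t) \<and>
    (\<forall>\<phi>\<in>smooth_funs A. \<forall>s\<in>S. \<forall>t\<in>S. D (\<phi> *\<^sub>C s) t = \<phi> *\<^sub>C D s t) \<and>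
    (\<forall>\<phi>\<in>smooth_funs A. \<forall>s\<in>S. \<forall>t\<in>S.
       D s (\<phi> *\<^sub>C t) = \<phi> *\<^sub>C D s t + dir_deriv (\<rho> s) \<phi> *\<^sub>C t)"

definition levi_civita_on ::
  "('m::{t2_space, second_countable_topology}, 'e::real_normed_vector) chart set \<Rightarrow>
   ('m \<Rightarrow> 'x::real_vector) set \<Rightarrow> (('m \<Rightarrow> 'x) \<Rightarrow> 'm \<Rightarrow> 'm tvec) \<Rightarrow>
   (('m \<Rightarrow> 'x) \<Rightarrow> ('m \<Rightarrow> 'x) \<Rightarrow> 'm \<Rightarrow> 'x) \<Rightarrow> ('m \<Rightarrow> 'x \<Rightarrow> 'x \<Rightarrow> real) \<Rightarrow>
   (('m \<Rightarrow> 'x) \<Rightarrow> ('m \<Rightarrow> 'x) \<Rightarrow> 'm \<Rightarrow> 'x) \<Rightarrow> bool"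
  where "levi_civita_on A S \<rho> br h D \<longleftrightarrow>
    derivative_on A S \<rho> D \<and>
    (\<forall>s\<in>S. \<forall>t\<in>S. D s t - D t s = br s t) \<and>
    (\<forall>s\<in>S. \<forall>t\<in>S. \<forall>u\<in>S. dir_deriv (\<rho> s) (h \<odot> t \<odot> u) = h \<odot> D s t \<odot> u + h \<odot> t \<odot> D s u)"

definition levi_civita_connection ::
  "('m::{t2_space, second_countable_topology}, 'e::real_normed_vector) chart set \<Rightarrow>
   ('m \<Rightarrow> 'm tvec \<Rightarrow> 'm tvec \<Rightarrow> real) \<Rightarrow>
   (('m \<Rightarrow> 'm tvec) \<Rightarrow> ('m \<Rightarrow> 'm tvec) \<Rightarrow> 'm \<Rightarrow> 'm tvec) \<Rightarrow> bool"
  where "levi_civita_connection A g N \<longleftrightarrow>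
    levi_civita_on A (vector_fields A) (\<lambda>X. X) (lie_bracket A) g N"

definition contravariant_levi_civita ::
  "('m::{t2_space, second_countable_topology}, 'e::real_normed_vector) chart set \<Rightarrow>
   ('m \<Rightarrow> 'm covec \<Rightarrow> 'm covec \<Rightarrow> real) \<Rightarrow> ('m \<Rightarrow> 'm tvec) \<Rightarrow>
   ('m \<Rightarrow> 'm tvec \<Rightarrow> 'm tvec \<Rightarrow> real) \<Rightarrow>
   (('m \<Rightarrow> 'm covec) \<Rightarrow> ('m \<Rightarrow> 'm covec) \<Rightarrow> 'm \<Rightarrow> 'm covec) \<Rightarrow> bool"
  where "contravariant_levi_civita A \<pi> \<xi> g D \<longleftrightarrow>
    levi_civita_on A (one_forms A) (\<lambda>\<alpha>. anchor A \<pi> \<xi> \<odot> \<alpha>) (bracket_g A \<pi> \<xi> g) (cometric A g) D"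

end

theory Submission
  imports Defs
begin

text \<open>Write \<open>\<rho>\<close> for the anchor. The section
  \<open>E(\<alpha>, \<beta>) = \<rho>(D\<^sub>\<alpha> \<beta>) - N\<^sub>\<rho>\<^sub>\<alpha> (\<rho> \<beta>)\<close> measures the failure of the claim. It is symmetric:
  both derivatives are torsion free for their brackets, and the pre-Lie condition says that
  \<open>\<rho>\<close> carries one bracket to the other. Pairing it with \<open>\<rho> \<gamma>\<close>, the function
  \<open>T(\<alpha>, \<beta>, \<gamma>) = g(E(\<alpha>, \<beta>), \<rho> \<gamma>)\<close> is skew in \<open>\<beta>, \<gamma>\<close>: both derivatives are metric, and since
  \<open>\<rho>\<close> is an isometry, both sides differentiate the same function \<open>g(\<rho> \<beta>, \<rho> \<gamma>) = g\<^sup>*(\<beta>, \<gamma>)\<close> along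
  \<open>\<rho> \<alpha>\<close>. A function of three arguments that is symmetric in the first two and skew in the last
  two vanishes (\<open>symmetric_skew_zero\<close>); this is the argument behind the uniqueness
  of the Levi-Civita connection. Since \<open>g\<close> is nondegenerate, \<open>E = 0\<close> follows once the vectors
  \<open>\<rho>(\<gamma>)\<close> at \<open>p\<close> fill the tangent space.

  That last point is linear algebra: \<open>\<rho>\<close> after \<open>flat\<close> is a linear isometry of the
  finite-dimensional space \<open>T\<^sub>pM\<close>, hence injective, hence onto
  (\<open>isometric_anchor_surjective\<close>). It presupposes that the isometry condition, which is given
  for global one-forms, holds for all covectors at \<open>p\<close>, so each covector has to extend to a
  global one-form. Tangent vectors are functionals on the global smooth functions, so those
  functions separate them, and a separating family of functionals
  on a finite-dimensional space contains a basis of its dual. Hence every covector at \<open>p\<close> is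
  the value of some differential \<open>df\<close> (\<open>covector_is_differential\<close>). The same duality argument
  gives \<open>T\<^sub>p\<^sup>*\<^sup>*M = T\<^sub>pM\<close> (\<open>bidual_is_evaluation\<close>), on which the existence of \<open>sharp_pi\<close>
  rests.\<close>

section \<open>Finite-dimensional linear algebra on subspaces\<close>

lemma scaleR_fun_apply [simp]: "(c *\<^sub>R f) x = c *\<^sub>R f x"
  by (simp add: scaleR_fun_def)

lemma lin_onD_add: "lin_on V a \<Longrightarrow> u \<in> V \<Longrightarrow> v \<in> V \<Longrightarrow> a (u + v) = a u + a v"
  and lin_onD_scale: "lin_on V a \<Longrightarrow> v \<in> V \<Longrightarrow> a (c *\<^sub>R v) = c * a v"
  by (auto simp: lin_on_def)

lemma lin_onD_zero: "lin_on V a \<Longrightarrow> subspace V \<Longrightarrow> a 0 = 0"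
  using lin_onD_scale[of V a 0 0] by (simp add: subspace_0)

lemma lin_onD_diff:
  assumes "lin_on V a" "subspace V" "u \<in> V" "v \<in> V"
  shows "a (u - v) = a u - a v"
proof -
  have "a (u + (- 1) *\<^sub>R v) = a u + (- 1) * a v"
    using assms by (simp only: lin_onD_add lin_onD_scale subspace_scale)
  then show ?thesis by simp
qed

lemma lin_on_sum:
  assumes "lin_on V a" "subspace V" "finite I" "\<And>i. i \<in> I \<Longrightarrow> x i \<in> V"
  shows "a (\<Sum>i\<in>I. k i *\<^sub>R x i) = (\<Sum>i\<in>I. k i * a (x i))"
  using assms(3,4)
proof (induction I)
  case empty
  then show ?case using lin_onD_zero[OF assms(1,2)] by simp
next
  case (insert i I)
  have "(\<Sum>i\<in>I. k i *\<^sub>R x i) \<in> V" "k i *\<^sub>R x i \<in> V"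
    using insert assms(2) by (auto intro!: subspace_sum subspace_scale)
  then show ?case
    using insert assms(1) by (simp add: lin_onD_add lin_onD_scale)
qed

lemma lin_on_mono: "lin_on V a \<Longrightarrow> U \<subseteq> V \<Longrightarrow> lin_on U a"
  unfolding lin_on_def by (meson subsetD)

lemma lin_on_eq_on_span:
  assumes "lin_on (span B) a" "lin_on (span B) b" "\<And>x. x \<in> B \<Longrightarrow> a x = b x" "v \<in> span B"
  shows "a v = b v"
proof -
  have "v \<in> span B \<and> a v = b v"
    using assms(4)
  proof (induction rule: span_induct_alt)
    case base
    then show ?case
      using lin_onD_zero[OF assms(1)] lin_onD_zero[OF assms(2)] by (simp add: span_zero)
  next
    case (step c x y)
    then have "c *\<^sub>R x \<in> span B" "x \<in> span B"
      by (auto intro: span_base span_scale)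
    then show ?case
      using step assms(1-3) by (simp add: lin_onD_add lin_onD_scale span_add)
  qed
  then show ?thesis ..
qed

text \<open>If the functionals \<open>pair w\<close> separate the span of \<open>B\<close>, then some of them form a dual basis
  of \<open>B\<close>, and their combinations take arbitrary values on \<open>B\<close>. The induction is Gram-Schmidt for functionals: given a dual basis \<open>d\<close> of \<open>B\<close> and a new
  vector \<open>b\<close>, the difference \<open>z\<close> of \<open>b\<close> and the combination of \<open>B\<close> on which the \<open>d\<close> take the
  same values as on \<open>b\<close> is nonzero by independence, so some \<open>w\<close> does not vanish on it; subtracting the \<open>d\<close>-part of \<open>w\<close> makes it vanish on \<open>B\<close> but not at \<open>b\<close>.\<close>
lemma separating_pairing_interpolates:
  fixes pair :: "'w::real_vector \<Rightarrow> 'v::real_vector \<Rightarrow> real"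
  assumes "finite B" "independent B" "subspace W"
    and "\<And>w. w \<in> W \<Longrightarrow> lin_on (span B) (pair w)"
    and "\<And>v. v \<in> span B \<Longrightarrow> lin_on W (\<lambda>w. pair w v)"
    and "\<And>v. v \<in> span B \<Longrightarrow> (\<And>w. w \<in> W \<Longrightarrow> pair w v = 0) \<Longrightarrow> v = 0"
  shows "\<exists>w\<in>W. \<forall>b\<in>B. pair w b = c b"
  using assms
proof (induction B arbitrary: c)
  case empty
  then show ?case using subspace_0 by auto
next
  case (insert b B)
  note W = \<open>subspace W\<close>
  note lin1 = insert.prems(3) and lin2 = insert.prems(4) and sep = insert.prems(5)
  have sub: "span B \<subseteq> span (insert b B)" by (rule span_mono) auto
  have b_in: "b \<in> span (insert b B)" by (rule span_base) simp
  have B_in: "x \<in> span (insert b B)" if "x \<in> B" for x using that by (simp add: span_base)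
  have indB: "independent B" "b \<notin> span B"
    using insert.prems(1) insert.hyps independent_insert by (metis)+
  have IH: "\<exists>w\<in>W. \<forall>b\<in>B. pair w b = c b" for c
  proof (rule insert.IH[OF indB(1) W])
    show "lin_on (span B) (pair w)" if "w \<in> W" for w by (rule lin_on_mono[OF lin1[OF that] sub])
    show "lin_on W (\<lambda>w. pair w v)" if "v \<in> span B" for v
      using that sub by (intro lin2) blast
    show "v = 0" if "v \<in> span B" "\<And>w. w \<in> W \<Longrightarrow> pair w v = 0" for v
      by (rule sep) (use that sub in auto)
  qed
  have "\<forall>x. \<exists>w. w \<in> W \<and> (\<forall>y\<in>B. pair w y = (if y = x then 1 else 0))"
    using IH[of "\<lambda>y. if y = x then 1 else 0" for x] by (simp add: Bex_def)
  then obtain d where "\<forall>x. d x \<in> W \<and> (\<forall>y\<in>B. pair (d x) y = (if y = x then 1 else 0))"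
    by (rule choice[THEN exE])
  then have dW: "\<And>x. d x \<in> W"
    and d: "\<And>x y. y \<in> B \<Longrightarrow> pair (d x) y = (if y = x then 1 else 0)"
    by auto
  \<comment> \<open>\<open>z\<close> and \<open>e\<close> are the parts of \<open>b\<close> and \<open>w\<close> that the projections to \<open>B\<close> and to \<open>d\<close> miss;
    they are adjoint: \<open>pair e b = pair w z\<close>.\<close>
  define z where "z = b - (\<Sum>x\<in>B. pair (d x) b *\<^sub>R x)"
  have sum_in: "(\<Sum>x\<in>B. pair (d x) b *\<^sub>R x) \<in> span B"
    by (intro span_sum span_scale span_base)
  have "z \<noteq> 0" using sum_in indB(2) by (auto simp: z_def)
  moreover have "z \<in> span (insert b B)"
    unfolding z_def by (rule span_diff[OF b_in subsetD[OF sub sum_in]])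
  ultimately obtain w where w: "w \<in> W" "pair w z \<noteq> 0"
    using sep by blast
  have pw: "pair w z = pair w b - (\<Sum>x\<in>B. pair (d x) b * pair w x)"
    unfolding z_def
    using lin_onD_diff[OF lin1[OF w(1)] subspace_span b_in subsetD[OF sub sum_in]]
      lin_on_sum[OF lin1[OF w(1)] subspace_span insert.hyps(1) B_in] by simp
  define e where "e = w - (\<Sum>x\<in>B. pair w x *\<^sub>R d x)"
  have sumW: "(\<Sum>x\<in>B. pair w x *\<^sub>R d x) \<in> W"
    using W dW by (intro subspace_sum subspace_scale)
  have eW: "e \<in> W" unfolding e_def by (rule subspace_diff[OF W w(1) sumW])
  have pe: "pair e v = pair w v - (\<Sum>x\<in>B. pair w x * pair (d x) v)"
    if "v \<in> span (insert b B)" for v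
    unfolding e_def
    using lin_onD_diff[OF lin2[OF that] W w(1) sumW]
      lin_on_sum[OF lin2[OF that] W insert.hyps(1) dW] by simp
  have e0: "pair e y = 0" if "y \<in> B" for y
    using pe[OF B_in[OF that]] d[OF that] that insert.hyps(1)
    by (simp add: if_distrib cong: if_cong)
  have eb: "pair e b \<noteq> 0"
    using w(2) pw pe[OF b_in] by (simp add: mult.commute)
  obtain w' where w': "w' \<in> W" "\<forall>y\<in>B. pair w' y = c y" using IH by blast
  define k where "k = (c b - pair w' b) / pair e b"
  have ke: "k *\<^sub>R e \<in> W" using eW W by (simp add: subspace_scale)
  have val: "pair (w' + k *\<^sub>R e) v = pair w' v + k * pair e v"
    if "v \<in> span (insert b B)" for v
    using lin_onD_add[OF lin2[OF that] w'(1) ke] lin_onD_scale[OF lin2[OF that] eW] by simp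
  have "\<forall>y\<in>insert b B. pair (w' + k *\<^sub>R e) y = c y"
    using val[OF b_in] val[OF B_in] w'(2) e0 eb by (auto simp: k_def)
  moreover have "w' + k *\<^sub>R e \<in> W" using w' ke W by (simp add: subspace_add)
  ultimately show ?case by blast
qed

text \<open>On a finite-dimensional space, a linear space of functionals that separates points is the
  whole dual.\<close>
lemma separating_pairing_represents:
  fixes pair :: "'w::real_vector \<Rightarrow> 'v::real_vector \<Rightarrow> real"
  assumes "finite B" "independent B" "subspace W"
    and "\<And>w. w \<in> W \<Longrightarrow> lin_on (span B) (pair w)"
    and "\<And>v. v \<in> span B \<Longrightarrow> lin_on W (\<lambda>w. pair w v)"
    and "\<And>v. v \<in> span B \<Longrightarrow> (\<And>w. w \<in> W \<Longrightarrow> pair w v = 0) \<Longrightarrow> v = 0"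
    and "lin_on (span B) a"
  shows "\<exists>w\<in>W. \<forall>v\<in>span B. pair w v = a v"
proof -
  have "\<exists>w\<in>W. \<forall>b\<in>B. pair w b = a b"
    by (rule separating_pairing_interpolates) (fact assms)+
  then obtain w where w: "w \<in> W" "\<And>b. b \<in> B \<Longrightarrow> pair w b = a b" by auto
  show ?thesis
    using lin_on_eq_on_span[OF assms(4)[OF w(1)] assms(7) w(2)] w(1) by blast
qed

text \<open>The map is linear only on the subspace. Extending its values on \<open>B\<close> to a linear map of the
  whole space makes the usual dimension count available.\<close>
lemma injective_endomorphism_surjective:
  fixes F :: "'v::real_vector \<Rightarrow> 'v"
  assumes fin: "finite B" and ind: "independent B"
    and into: "\<And>v. v \<in> span B \<Longrightarrow> F v \<in> span B"
    and add: "\<And>u v. u \<in> span B \<Longrightarrow> v \<in> span B \<Longrightarrow> F (u + v) = F u + F v"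
    and scale: "\<And>c v. v \<in> span B \<Longrightarrow> F (c *\<^sub>R v) = c *\<^sub>R F v"
    and ker: "\<And>v. v \<in> span B \<Longrightarrow> F v = 0 \<Longrightarrow> v = 0"
  shows "F ` span B = span B"
proof -
  define G where "G = construct B F"
  have lin: "linear G" unfolding G_def by (rule linear_construct[OF ind])
  have GF: "G v = F v" if "v \<in> span B" for v
  proof -
    have "v \<in> span B \<and> G v = F v"
      using that
    proof (induction rule: span_induct_alt)
      case base
      then show ?case using scale[of 0 0] by (simp add: span_zero linear_0[OF lin])
    next
      case (step c x y)
      then have "x \<in> span B" "c *\<^sub>R x \<in> span B" by (auto intro: span_base span_scale)
      moreover have "G x = F x" using step construct_basis[OF ind] by (simp add: G_def)
      ultimately show ?case
        using step by (simp add: span_add add scale linear_add[OF lin] linear_scale[OF lin])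
    qed
    then show ?thesis ..
  qed
  have inj: "inj_on G (span B)"
    using ker GF by (subst linear_inj_on_iff_eq_0[OF lin subspace_span]) auto
  have indG: "independent (G ` B)"
    by (rule linear_independent_injective_image[OF lin ind inj])
  have cardG: "card (G ` B) = card B"
    by (rule card_image) (rule inj_on_subset[OF inj span_superset])
  have subG: "G ` B \<subseteq> span B" using GF into by (auto simp: span_base)
  have "span B \<subseteq> span (G ` B)"
  proof
    fix x assume x: "x \<in> span B"
    show "x \<in> span (G ` B)"
    proof (rule ccontr)
      assume nx: "x \<notin> span (G ` B)"
      then have "independent (insert x (G ` B))" using indG by (simp add: independent_insertI)
      moreover have "insert x (G ` B) \<subseteq> span B" using subG x by simp
      ultimately have "card (insert x (G ` B)) \<le> card B"
        using independent_span_bound[OF fin] by simp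
      moreover have "x \<notin> G ` B" using nx by (auto simp: span_base)
      ultimately show False using fin cardG by simp
    qed
  qed
  also have "span (G ` B) = F ` span B"
    using GF by (simp add: linear_span_image[OF lin])
  finally show ?thesis using into by blast
qed


section \<open>Smooth functions\<close>

text \<open>Openness of \<open>S\<close> is essential: the derivative at a point of \<open>S\<close> depends on the values in a
  neighbourhood.\<close>
lemma Ck_on_cong:
  assumes "open S" "\<And>x. x \<in> S \<Longrightarrow> f x = h x" "Ck_on k f S"
  shows "Ck_on k h S"
  using assms(2,3)
proof (induction k arbitrary: f h)
  case 0
  then show ?case by (simp cong: continuous_on_cong)
next
  case (Suc k)
  have der: "(h has_derivative frechet_derivative f (at x)) (at x)" if "x \<in> S" for x
  proof -
    have "(f has_derivative frechet_derivative f (at x)) (at x)"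
      using Suc.prems(2) that by (simp add: frechet_derivative_works)
    then show ?thesis
      by (rule has_derivative_transform_within_open[OF _ assms(1) that]) (use Suc.prems in auto)
  qed
  have "frechet_derivative f (at x) v = frechet_derivative h (at x) v" if "x \<in> S" for x v
    using frechet_derivative_at[OF der[OF that]] by simp
  then have "Ck_on k (\<lambda>x. frechet_derivative h (at x) v) S" for v
    using Suc.IH[of "\<lambda>x. frechet_derivative f (at x) v"] Suc.prems(2) by simp
  then show ?case using der by (auto simp: differentiable_def)
qed

lemma Ck_on_Suc_lower: "Ck_on (Suc k) f S \<Longrightarrow> Ck_on k f S"
proof (induction k arbitrary: f)
  case 0
  then show ?case
    by (auto intro!: continuous_at_imp_continuous_on differentiable_imp_continuous_within)
next
  case (Suc k)
  have "\<forall>x\<in>S. f differentiable at x"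
    using Suc.prems by (rule Ck_on.simps(2)[THEN iffD1, THEN conjunct1])
  moreover have "Ck_on k (\<lambda>x. frechet_derivative f (at x) v) S" for v
    using Suc.prems by (intro Suc.IH) (rule Ck_on.simps(2)[THEN iffD1, THEN conjunct2, THEN spec])
  ultimately show ?case by simp
qed

lemma Ck_on_const: "Ck_on k (\<lambda>x. c) S"
  by (induction k arbitrary: c) (auto simp: frechet_derivative_const)

lemma Ck_on_add:
  assumes "open S" "Ck_on k f S" "Ck_on k h S"
  shows "Ck_on k (\<lambda>x. f x + h x) S"
  using assms(2,3)
proof (induction k arbitrary: f h)
  case 0
  then show ?case by (auto intro: continuous_intros)
next
  case (Suc k)
  have "Ck_on k (\<lambda>x. frechet_derivative f (at x) v + frechet_derivative h (at x) v) S" for v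
    using Suc by simp
  moreover have "frechet_derivative f (at x) v + frechet_derivative h (at x) v
      = frechet_derivative (\<lambda>x. f x + h x) (at x) v" if "x \<in> S" for x v
  proof -
    have "(f has_derivative frechet_derivative f (at x)) (at x)"
      "(h has_derivative frechet_derivative h (at x)) (at x)"
      using Suc.prems that by (simp_all add: frechet_derivative_works)
    from frechet_derivative_at[OF has_derivative_add[OF this]] show ?thesis
      by (rule fun_cong)
  qed
  ultimately have "Ck_on k (\<lambda>x. frechet_derivative (\<lambda>x. f x + h x) (at x) v) S" for v
    by (rule Ck_on_cong[OF assms(1), rotated])
  then show ?case using Suc.prems by auto
qed

lemma Ck_on_mult:
  fixes f h :: "'a::real_normed_vector \<Rightarrow> real"
  assumes "open S" "Ck_on k f S" "Ck_on k h S"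
  shows "Ck_on k (\<lambda>x. f x * h x) S"
  using assms(2,3)
proof (induction k arbitrary: f h)
  case 0
  then show ?case by (auto intro: continuous_intros)
next
  case (Suc k)
  have "f x * frechet_derivative h (at x) v + frechet_derivative f (at x) v * h x
      = frechet_derivative (\<lambda>x. f x * h x) (at x) v"
    if "x \<in> S" for x v
  proof -
    have "(f has_derivative frechet_derivative f (at x)) (at x)"
      "(h has_derivative frechet_derivative h (at x)) (at x)"
      using Suc.prems that by (simp_all add: frechet_derivative_works)
    from frechet_derivative_at[OF has_derivative_mult[OF this]] show ?thesis
      by (rule fun_cong)
  qed
  moreover have "Ck_on k (\<lambda>x. f x * frechet_derivative h (at x) v
      + frechet_derivative f (at x) v * h x) S" for v
  proof (rule Ck_on_add[OF assms(1)]; rule Suc.IH)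
    show "Ck_on k f S" "Ck_on k h S" by (rule Suc.prems[THEN Ck_on_Suc_lower])+
    show "Ck_on k (\<lambda>x. frechet_derivative f (at x) v) S"
      "Ck_on k (\<lambda>x. frechet_derivative h (at x) v) S"
      using Suc.prems by simp_all
  qed
  ultimately have "Ck_on k (\<lambda>x. frechet_derivative (\<lambda>x. f x * h x) (at x) v) S" for v
    by (rule Ck_on_cong[OF assms(1)])
  then show ?case using Suc.prems by (auto intro: differentiable_mult)
qed

lemma chart_image_open: "smooth_manifold A \<Longrightarrow> (U, \<phi>) \<in> A \<Longrightarrow> open (\<phi> ` U)"
  by (auto simp: smooth_manifold_def)

lemma smooth_funs_add:
  assumes "smooth_manifold A" "f \<in> smooth_funs A" "h \<in> smooth_funs A"
  shows "f + h \<in> smooth_funs A"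
proof -
  have "Ck_on k ((f + h) \<circ> inv_into U \<phi>) (\<phi> ` U)" if c: "(U, \<phi>) \<in> A" for U \<phi> k
  proof -
    have "Ck_on k (f \<circ> inv_into U \<phi>) (\<phi> ` U)" "Ck_on k (h \<circ> inv_into U \<phi>) (\<phi> ` U)"
      using assms(2,3) c by (auto simp: smooth_funs_def smooth_on_def)
    from Ck_on_add[OF chart_image_open[OF assms(1) c] this] show ?thesis
      by (simp add: comp_def)
  qed
  then show ?thesis by (auto simp: smooth_funs_def smooth_on_def)
qed

lemma smooth_funs_mult:
  assumes "smooth_manifold A" "f \<in> smooth_funs A" "h \<in> smooth_funs A"
  shows "f * h \<in> smooth_funs A"
proof -
  have "Ck_on k ((f * h) \<circ> inv_into U \<phi>) (\<phi> ` U)" if c: "(U, \<phi>) \<in> A" for U \<phi> k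
  proof -
    have "Ck_on k (f \<circ> inv_into U \<phi>) (\<phi> ` U)" "Ck_on k (h \<circ> inv_into U \<phi>) (\<phi> ` U)"
      using assms(2,3) c by (auto simp: smooth_funs_def smooth_on_def)
    from Ck_on_mult[OF chart_image_open[OF assms(1) c] this] show ?thesis
      by (simp add: comp_def)
  qed
  then show ?thesis by (auto simp: smooth_funs_def smooth_on_def)
qed

lemma smooth_funs_const: "(\<lambda>p. c) \<in> smooth_funs A"
  by (auto simp: smooth_funs_def smooth_on_def comp_def Ck_on_const)

lemma subspace_smooth_funs:
  assumes "smooth_manifold A"
  shows "subspace (smooth_funs A)"
proof (rule subspaceI)
  show "0 \<in> smooth_funs A" using smooth_funs_const[of 0 A] by (simp add: zero_fun_def)
  show "c *\<^sub>R f \<in> smooth_funs A" if "f \<in> smooth_funs A" for c f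
    using smooth_funs_mult[OF assms smooth_funs_const[of c] that]
    by (simp add: times_fun_def scaleR_fun_def)
qed (rule smooth_funs_add[OF assms])


section \<open>Tangent and cotangent spaces\<close>

definition coord_vector ::
  "('m::{t2_space, second_countable_topology}, 'e::real_normed_vector) chart set \<Rightarrow>
   'm set \<Rightarrow> ('m \<Rightarrow> 'e) \<Rightarrow> 'm \<Rightarrow> 'e \<Rightarrow> 'm tvec"
  where "coord_vector A U \<phi> p w = (\<lambda>f. if f \<in> smooth_funs A
    then frechet_derivative (f \<circ> inv_into U \<phi>) (at (\<phi> p)) w else 0)"

lemma tangent_space_iff:
  "v \<in> tangent_space A p \<longleftrightarrow> (\<exists>U \<phi> w. (U, \<phi>) \<in> A \<and> p \<in> U \<and> v = coord_vector A U \<phi> p w)"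
  unfolding tangent_space_def coord_vector_def by fast

lemma smooth_fun_differentiable:
  assumes "f \<in> smooth_funs A" "(U, \<phi>) \<in> A" "p \<in> U"
  shows "(f \<circ> inv_into U \<phi>) differentiable at (\<phi> p)"
proof -
  have "Ck_on (Suc 0) (f \<circ> inv_into U \<phi>) (\<phi> ` U)"
    using assms by (auto simp: smooth_funs_def smooth_on_def simp del: Ck_on.simps)
  then show ?thesis using assms by auto
qed

lemma linear_coord_vector:
  assumes "(U, \<phi>) \<in> A" "p \<in> U"
  shows "linear (coord_vector A U \<phi> p)"
proof -
  have "linear (frechet_derivative (f \<circ> inv_into U \<phi>) (at (\<phi> p)))" if "f \<in> smooth_funs A" for f
    using linear_frechet_derivative smooth_fun_differentiable[OF that assms] by blast
  then show ?thesis
    by (intro linearI) (auto simp: coord_vector_def fun_eq_iff linear_add linear_scale)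
qed

text \<open>By the chain rule applied to \<open>f \<circ> \<phi>\<^sup>-\<^sup>1 = (f \<circ> \<psi>\<^sup>-\<^sup>1) \<circ> (\<psi> \<circ> \<phi>\<^sup>-\<^sup>1)\<close> near \<open>\<phi> p\<close>, so that all charts
  around \<open>p\<close> produce the same tangent vectors.\<close>
lemma coord_vector_change_chart:
  assumes M: "smooth_manifold A" and c: "(U, \<phi>) \<in> A" "p \<in> U" "(V, \<psi>) \<in> A" "p \<in> V"
  shows "coord_vector A U \<phi> p w =
    coord_vector A V \<psi> p (frechet_derivative (\<psi> \<circ> inv_into U \<phi>) (at (\<phi> p)) w)"
proof -
  let ?t = "\<psi> \<circ> inv_into U \<phi>"
  have hU: "homeomorphism U (\<phi> ` U) \<phi> (inv_into U \<phi>)" "open U" "open (\<phi> ` U)" and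
    hV: "homeomorphism V (\<psi> ` V) \<psi> (inv_into V \<psi>)" "open V"
    using M c by (auto simp: smooth_manifold_def)
  have opn: "open (\<phi> ` (U \<inter> V))"
  proof -
    have "openin (top_of_set (\<phi> ` U)) (\<phi> ` (U \<inter> V))"
      by (rule homeomorphism_imp_open_map[OF hU(1)]) (use hV(2) openin_open_Int in blast)
    then show ?thesis using hU(3) by (rule openin_open_trans)
  qed
  have "smooth_on (\<phi> ` (U \<inter> V)) ?t" using M c by (auto simp: smooth_manifold_def)
  then have "Ck_on (Suc 0) ?t (\<phi> ` (U \<inter> V))" unfolding smooth_on_def by blast
  then have "?t differentiable at (\<phi> p)" using c by auto
  then have dt: "(?t has_derivative frechet_derivative ?t (at (\<phi> p))) (at (\<phi> p))"
    by (simp add: frechet_derivative_works)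
  have tp: "?t (\<phi> p) = \<psi> p" using homeomorphism_apply1[OF hU(1)] c by simp
  have "frechet_derivative (f \<circ> inv_into U \<phi>) (at (\<phi> p)) w
    = frechet_derivative (f \<circ> inv_into V \<psi>) (at (\<psi> p)) (frechet_derivative ?t (at (\<phi> p)) w)"
    if f: "f \<in> smooth_funs A" for f
  proof -
    have "(f \<circ> inv_into V \<psi> has_derivative frechet_derivative (f \<circ> inv_into V \<psi>) (at (\<psi> p)))
      (at (?t (\<phi> p)))"
      unfolding tp using smooth_fun_differentiable[OF f c(3,4)]
      by (simp add: frechet_derivative_works)
    from diff_chain_at[OF dt this]
    have "(f \<circ> inv_into U \<phi> has_derivative
      frechet_derivative (f \<circ> inv_into V \<psi>) (at (\<psi> p)) \<circ> frechet_derivative ?t (at (\<phi> p)))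
      (at (\<phi> p))"
    proof (rule has_derivative_transform_within_open[OF _ opn])
      fix x assume "x \<in> \<phi> ` (U \<inter> V)"
      then show "((f \<circ> inv_into V \<psi>) \<circ> ?t) x = (f \<circ> inv_into U \<phi>) x"
        using homeomorphism_apply1[OF hU(1)] homeomorphism_apply1[OF hV(1)] by auto
    qed (use c in simp)
    from frechet_derivative_at[OF this, THEN fun_cong, of w] show ?thesis by simp
  qed
  then show ?thesis by (auto simp: coord_vector_def)
qed

text \<open>A single chart suffices, which exhibits the tangent space as a linear image of the model
  space; it is therefore a finite-dimensional vector space.\<close>
lemma tangent_space_chart:
  assumes M: "smooth_manifold A" and c: "(U, \<phi>) \<in> A" "p \<in> U"
  shows "tangent_space A p = range (coord_vector A U \<phi> p)"
proof
  show "tangent_space A p \<subseteq> range (coord_vector A U \<phi> p)"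
  proof
    fix v assume "v \<in> tangent_space A p"
    then obtain V \<psi> w where "(V, \<psi>) \<in> A" "p \<in> V" "v = coord_vector A V \<psi> p w"
      unfolding tangent_space_iff by blast
    then show "v \<in> range (coord_vector A U \<phi> p)"
      using coord_vector_change_chart[OF M _ _ c] by simp
  qed
  show "range (coord_vector A U \<phi> p) \<subseteq> tangent_space A p"
  proof (rule image_subsetI)
    show "coord_vector A U \<phi> p w \<in> tangent_space A p" for w
      unfolding tangent_space_iff by (intro exI conjI) (rule c refl)+
  qed
qed

lemma chart_at:
  assumes "smooth_manifold A"
  obtains U \<phi> where "(U, \<phi>) \<in> A" "p \<in> U"
proof -
  have "p \<in> (\<Union>(U, \<phi>)\<in>A. U)" using assms by (simp add: smooth_manifold_def)
  then show ?thesis using that by auto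
qed

lemma tangent_space_basis:
  assumes M: "smooth_manifold (A :: ('m::{t2_space, second_countable_topology},
    'e::real_normed_vector) chart set)"
  obtains B where "finite B" "independent B" "span B = tangent_space A p"
proof -
  obtain U \<phi> where c: "(U, \<phi>) \<in> A" "p \<in> U" using chart_at[OF M] .
  let ?L = "coord_vector A U \<phi> p"
  obtain C :: "'e set" where C: "finite C" "span C = UNIV"
    using M by (auto simp: smooth_manifold_def)
  have L: "span (?L ` C) = tangent_space A p"
    using linear_span_image[OF linear_coord_vector[OF c]] C tangent_space_chart[OF M c] by simp
  obtain B where B: "B \<subseteq> ?L ` C" "independent B" "?L ` C \<subseteq> span B"
    using maximal_independent_subset[of "?L ` C"] by blast
  have "span B = span (?L ` C)"
    by (rule subset_antisym[OF span_mono[OF B(1)] span_minimal[OF B(3) subspace_span]])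
  moreover have "finite B" by (rule finite_subset[OF B(1) finite_imageI[OF C(1)]])
  ultimately show ?thesis using that[OF _ B(2)] L by simp
qed

lemma subspace_tangent_space:
  assumes "smooth_manifold A"
  shows "subspace (tangent_space A p)"
proof -
  obtain B where "span B = tangent_space A p" using tangent_space_basis[OF assms, of p] .
  then show ?thesis using subspace_span[of B] by simp
qed

lemma lin_on_tangent_vector:
  assumes "v \<in> tangent_space A p" "smooth_manifold A"
  shows "lin_on (smooth_funs A) v"
proof -
  obtain U \<phi> w where c: "(U, \<phi>) \<in> A" "p \<in> U" and v: "v = coord_vector A U \<phi> p w"
    using assms by (auto simp: tangent_space_iff)
  have der: "(f \<circ> inv_into U \<phi> has_derivative
      frechet_derivative (f \<circ> inv_into U \<phi>) (at (\<phi> p))) (at (\<phi> p))" if "f \<in> smooth_funs A" for f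
    using smooth_fun_differentiable[OF that c] by (simp add: frechet_derivative_works)
  have "v (f + h) = v f + v h" if "f \<in> smooth_funs A" "h \<in> smooth_funs A" for f h
  proof -
    have "((f + h) \<circ> inv_into U \<phi> has_derivative
       (\<lambda>x. frechet_derivative (f \<circ> inv_into U \<phi>) (at (\<phi> p)) x +
         frechet_derivative (h \<circ> inv_into U \<phi>) (at (\<phi> p)) x)) (at (\<phi> p))"
      using has_derivative_add[OF der[OF that(1)] der[OF that(2)]] by (simp add: comp_def)
    from frechet_derivative_at[OF this, THEN fun_cong, of w] show ?thesis
      using that smooth_funs_add[OF assms(2) that] by (simp add: v coord_vector_def)
  qed
  moreover have "v (k *\<^sub>R f) = k * v f" if "f \<in> smooth_funs A" for k f
  proof -
    have "(k *\<^sub>R f \<circ> inv_into U \<phi> has_derivative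
       (\<lambda>x. k *\<^sub>R frechet_derivative (f \<circ> inv_into U \<phi>) (at (\<phi> p)) x)) (at (\<phi> p))"
      using has_derivative_scaleR_right[OF der[OF that]] by (simp add: comp_def)
    from frechet_derivative_at[OF this, THEN fun_cong, of w] show ?thesis
      using that subspace_scale[OF subspace_smooth_funs[OF assms(2)] that]
      by (simp add: v coord_vector_def)
  qed
  ultimately show ?thesis by (simp add: lin_on_def)
qed

lemma tangent_vector_nonsmooth: "v \<in> tangent_space A p \<Longrightarrow> f \<notin> smooth_funs A \<Longrightarrow> v f = 0"
  by (auto simp: tangent_space_iff coord_vector_def)

lemma subspace_cotangent_space:
  assumes "smooth_manifold A"
  shows "subspace (cotangent_space A p)"
  by (rule subspaceI) (auto simp: cotangent_space_def lin_on_def algebra_simps)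

lemma covector_lin: "a \<in> cotangent_space A p \<Longrightarrow> lin_on (tangent_space A p) a"
  by (simp add: cotangent_space_def)

lemma covector_eqI:
  assumes "a \<in> cotangent_space A p" "b \<in> cotangent_space A p"
    and "\<And>v. v \<in> tangent_space A p \<Longrightarrow> a v = b v"
  shows "a = b"
  using assms by (fastforce simp: cotangent_space_def)

lemma differential_cotangent:
  assumes "smooth_manifold A"
  shows "differential A f p \<in> cotangent_space A p"
  using subspace_tangent_space[OF assms, of p]
  by (auto simp: cotangent_space_def differential_def lin_on_def subspace_add subspace_scale)

lemma differential_one_form:
  assumes "smooth_manifold A" "f \<in> smooth_funs A"
  shows "differential A f \<in> one_forms A"
proof -
  have "differential A f \<odot> X = dir_deriv X f" if "X \<in> vector_fields A" for X
    using that by (auto simp: fun_eq_iff fibre_app_def dir_deriv_def differential_def vector_fields_def)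
  then show ?thesis
    using assms differential_cotangent by (auto simp: one_forms_def vector_fields_def)
qed

text \<open>A tangent vector at \<open>p\<close> is
  determined by its values on the global smooth functions, so these separate the tangent space
  and thus represent every linear functional on it. In particular every covector extends to a
  global one-form.\<close>
lemma covector_is_differential:
  assumes M: "smooth_manifold A" and a: "a \<in> cotangent_space A p"
  obtains f where "f \<in> smooth_funs A" "differential A f p = a"
proof -
  obtain B where B: "finite B" "independent B" "span B = tangent_space A p"
    using tangent_space_basis[OF M] .
  have "\<exists>f\<in>smooth_funs A. \<forall>v\<in>span B. v f = a v"
  proof (rule separating_pairing_represents[OF B(1,2) subspace_smooth_funs[OF M]])
    show "lin_on (span B) (\<lambda>v. v f)" for f :: "'a \<Rightarrow> real"
      by (auto simp: lin_on_def)
    show "lin_on (smooth_funs A) v" if "v \<in> span B" for v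
      using that lin_on_tangent_vector[OF _ M] B(3) by auto
    show "v = 0" if "v \<in> span B" "\<And>f. f \<in> smooth_funs A \<Longrightarrow> v f = 0" for v
      using that B(3) tangent_vector_nonsmooth by (fastforce simp: fun_eq_iff)
    show "lin_on (span B) a" using a B(3) covector_lin by auto
  qed
  then obtain f where f: "f \<in> smooth_funs A" "\<forall>v\<in>tangent_space A p. v f = a v"
    using B(3) by auto
  have "differential A f p = a"
    by (rule covector_eqI[OF differential_cotangent[OF M] a]) (use f in \<open>simp add: differential_def\<close>)
  then show ?thesis using that f by blast
qed

lemma covectors_separate:
  assumes M: "smooth_manifold A" and "u \<in> tangent_space A p" "v \<in> tangent_space A p"
    and eq: "\<And>b. b \<in> cotangent_space A p \<Longrightarrow> b u = b v"
  shows "u = v"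
proof
  fix f
  show "u f = v f"
    using eq[OF differential_cotangent[OF M, of f]] assms(2,3) by (simp add: differential_def)
qed

text \<open>The vector is the sum of the \<open>h(d\<^sub>x) x\<close> over a basis \<open>B\<close> of the tangent space, where the
  covectors \<open>d\<^sub>x\<close> form the dual basis.\<close>
lemma bidual_is_evaluation:
  assumes M: "smooth_manifold A" and h: "lin_on (cotangent_space A p) h"
  shows "\<exists>v\<in>tangent_space A p. \<forall>b\<in>cotangent_space A p. b v = h b"
proof -
  obtain B where B: "finite B" "independent B" "span B = tangent_space A p"
    using tangent_space_basis[OF M] .
  note sub = subspace_cotangent_space[OF M, of p] and subT = subspace_tangent_space[OF M, of p]
  have "\<exists>d\<in>cotangent_space A p. \<forall>y\<in>B. d y = (if y = x then 1 else 0)" for x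
  proof (rule separating_pairing_interpolates[OF B(1,2) sub])
    show "lin_on (span B) a" if "a \<in> cotangent_space A p" for a
      using that B(3) covector_lin by auto
    show "lin_on (cotangent_space A p) (\<lambda>a. a v)" for v
      by (auto simp: lin_on_def)
    show "v = 0" if "v \<in> span B" "\<And>a. a \<in> cotangent_space A p \<Longrightarrow> a v = 0" for v
    proof (rule covectors_separate[OF M])
      show "v \<in> tangent_space A p" "0 \<in> tangent_space A p"
        using that B(3) subspace_0[OF subT] by auto
      show "b v = b 0" if "b \<in> cotangent_space A p" for b
        using lin_onD_zero[OF covector_lin[OF that] subT] that
          \<open>\<And>a. a \<in> cotangent_space A p \<Longrightarrow> a v = 0\<close> by simp
    qed
  qed
  then obtain d where d: "\<And>x. d x \<in> cotangent_space A p"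
    "\<And>x y. y \<in> B \<Longrightarrow> d x y = (if y = x then 1 else 0)"
    by metis
  define v where "v = (\<Sum>x\<in>B. h (d x) *\<^sub>R x)"
  have BT: "x \<in> tangent_space A p" if "x \<in> B" for x using B(3) that span_base by blast
  have "v \<in> tangent_space A p"
    unfolding v_def using BT subT by (auto intro!: subspace_sum subspace_scale)
  moreover have "b v = h b" if b: "b \<in> cotangent_space A p" for b
  proof -
    let ?b = "\<Sum>x\<in>B. b x *\<^sub>R d x"
    have b': "?b \<in> cotangent_space A p"
      using d sub by (auto intro!: subspace_sum subspace_scale)
    have "?b = b"
    proof (rule covector_eqI[OF b' b])
      fix u assume "u \<in> tangent_space A p"
      moreover have "?b y = b y" if "y \<in> B" for y
      proof -
        have "lin_on UNIV (\<lambda>a::'a covec. a y)" by (simp add: lin_on_def)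
        from lin_on_sum[OF this _ B(1), of d b] have "?b y = (\<Sum>x\<in>B. b x * d x y)" by simp
        then show ?thesis using d(2)[OF that] that B(1) by (simp add: if_distrib cong: if_cong)
      qed
      ultimately show "?b u = b u"
        using lin_on_eq_on_span[of B ?b b] covector_lin[OF b] covector_lin[OF b'] B(3) by simp
    qed
    then have "h b = (\<Sum>x\<in>B. b x * h (d x))"
      using lin_on_sum[OF h sub B(1) d(1), of b "\<lambda>x. x"] by simp
    also have "\<dots> = b v"
      unfolding v_def using lin_on_sum[OF covector_lin[OF b] subT B(1) BT]
      by (simp add: mult.commute)
    finally show ?thesis by simp
  qed
  ultimately show ?thesis by blast
qed


section \<open>The anchor\<close>

lemma sharp_pi:
  assumes M: "smooth_manifold A" and \<pi>: "bivector_field A \<pi>" and a: "a \<in> cotangent_space A p"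
  shows sharp_pi_tangent: "sharp_pi A \<pi> p a \<in> tangent_space A p"
    and sharp_pi_apply: "b \<in> cotangent_space A p \<Longrightarrow> b (sharp_pi A \<pi> p a) = \<pi> p a b"
proof -
  have "lin_on (cotangent_space A p) (\<pi> p a)"
    using \<pi> a by (auto simp: bivector_field_def bilin_on_def)
  from bidual_is_evaluation[OF M this]
  obtain v where v: "v \<in> tangent_space A p" "\<forall>b\<in>cotangent_space A p. b v = \<pi> p a b" ..
  have "sharp_pi A \<pi> p a = v"
    unfolding sharp_pi_def
  proof (rule the_equality)
    fix u assume "u \<in> tangent_space A p \<and> (\<forall>b\<in>cotangent_space A p. b u = \<pi> p a b)"
    then show "u = v" using covectors_separate[OF M, of u p v] v by simp
  qed (use v in simp)
  then show "sharp_pi A \<pi> p a \<in> tangent_space A p"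
    and "b \<in> cotangent_space A p \<Longrightarrow> b (sharp_pi A \<pi> p a) = \<pi> p a b"
    using v by simp_all
qed

lemma anchor:
  assumes M: "smooth_manifold A" and \<pi>: "bivector_field A \<pi>" and \<xi>: "\<xi> \<in> vector_fields A"
    and a: "a \<in> cotangent_space A p"
  shows anchor_tangent: "anchor A \<pi> \<xi> p a \<in> tangent_space A p"
    and anchor_apply: "b \<in> cotangent_space A p \<Longrightarrow>
      b (anchor A \<pi> \<xi> p a) = \<pi> p a b + a (\<xi> p) * b (\<xi> p)"
proof -
  note subT = subspace_tangent_space[OF M, of p]
  have x: "\<xi> p \<in> tangent_space A p" using \<xi> by (simp add: vector_fields_def)
  then have x': "a (\<xi> p) *\<^sub>R \<xi> p \<in> tangent_space A p" using subT by (simp add: subspace_scale)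
  note s = sharp_pi_tangent[OF M \<pi> a] sharp_pi_apply[OF M \<pi> a]
  show "anchor A \<pi> \<xi> p a \<in> tangent_space A p"
    unfolding anchor_def using x' s subT by (simp add: subspace_add)
  show "b (anchor A \<pi> \<xi> p a) = \<pi> p a b + a (\<xi> p) * b (\<xi> p)" if b: "b \<in> cotangent_space A p"
    unfolding anchor_def
    using lin_onD_add[OF covector_lin[OF b] s(1) x'] lin_onD_scale[OF covector_lin[OF b] x] s(2)[OF b]
    by simp
qed

lemma anchor_linear:
  assumes M: "smooth_manifold A" and \<pi>: "bivector_field A \<pi>" and \<xi>: "\<xi> \<in> vector_fields A"
    and a: "a \<in> cotangent_space A p"
  shows anchor_add: "b \<in> cotangent_space A p \<Longrightarrow>
      anchor A \<pi> \<xi> p (a + b) = anchor A \<pi> \<xi> p a + anchor A \<pi> \<xi> p b"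
    and anchor_scale: "anchor A \<pi> \<xi> p (k *\<^sub>R a) = k *\<^sub>R anchor A \<pi> \<xi> p a"
proof -
  note subT = subspace_tangent_space[OF M, of p] and sub = subspace_cotangent_space[OF M, of p]
  note an = anchor_tangent[OF M \<pi> \<xi>] and ap = anchor_apply[OF M \<pi> \<xi>]
  have lin: "lin_on (cotangent_space A p) (\<lambda>a. \<pi> p a c)" if "c \<in> cotangent_space A p" for c
    using \<pi> that by (auto simp: bivector_field_def bilin_on_def)
  show "anchor A \<pi> \<xi> p (a + b) = anchor A \<pi> \<xi> p a + anchor A \<pi> \<xi> p b"
    if b: "b \<in> cotangent_space A p"
  proof (rule covectors_separate[OF M an[OF subspace_add[OF sub a b]] subspace_add[OF subT an[OF a] an[OF b]]])
    fix c assume c: "c \<in> cotangent_space A p"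
    show "c (anchor A \<pi> \<xi> p (a + b)) = c (anchor A \<pi> \<xi> p a + anchor A \<pi> \<xi> p b)"
      using lin_onD_add[OF covector_lin[OF c] an[OF a] an[OF b]] lin_onD_add[OF lin[OF c] a b]
        ap[OF subspace_add[OF sub a b] c] ap[OF a c] ap[OF b c] by (simp add: algebra_simps)
  qed
  show "anchor A \<pi> \<xi> p (k *\<^sub>R a) = k *\<^sub>R anchor A \<pi> \<xi> p a"
  proof (rule covectors_separate[OF M an[OF subspace_scale[OF sub a]] subspace_scale[OF subT an[OF a]]])
    fix c assume c: "c \<in> cotangent_space A p"
    show "c (anchor A \<pi> \<xi> p (k *\<^sub>R a)) = c (k *\<^sub>R anchor A \<pi> \<xi> p a)"
      using lin_onD_scale[OF covector_lin[OF c] an[OF a]] lin_onD_scale[OF lin[OF c] a]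
        ap[OF subspace_scale[OF sub a] c] ap[OF a c] by (simp add: algebra_simps)
  qed
qed

lemma one_form_at: "\<alpha> \<in> one_forms A \<Longrightarrow> \<alpha> p \<in> cotangent_space A p"
  by (simp add: one_forms_def)

text \<open>Smoothness is tested on a function \<open>f\<close>, where
  \<open>\<rho>(\<alpha>)(f) = df(\<rho>(\<alpha>)) = \<pi>(\<alpha>, df) + \<alpha>(\<xi>) \<xi>(f)\<close>.\<close>
lemma anchor_vector_field:
  assumes M: "smooth_manifold A" and \<pi>: "bivector_field A \<pi>" and \<xi>: "\<xi> \<in> vector_fields A"
    and \<alpha>: "\<alpha> \<in> one_forms A"
  shows "anchor A \<pi> \<xi> \<odot> \<alpha> \<in> vector_fields A"
proof -
  have T: "(anchor A \<pi> \<xi> \<odot> \<alpha>) p \<in> tangent_space A p" for p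
    using anchor_tangent[OF M \<pi> \<xi> one_form_at[OF \<alpha>]] by (simp add: fibre_app_def)
  have "dir_deriv (anchor A \<pi> \<xi> \<odot> \<alpha>) f \<in> smooth_funs A" if f: "f \<in> smooth_funs A" for f
  proof -
    have "dir_deriv (anchor A \<pi> \<xi> \<odot> \<alpha>) f p
        = (\<pi> \<odot> \<alpha> \<odot> differential A f + (\<alpha> \<odot> \<xi>) * dir_deriv \<xi> f) p" for p
      using anchor_apply[OF M \<pi> \<xi> one_form_at[OF \<alpha>] differential_cotangent[OF M, of f p]] T[of p] \<xi>
      by (simp add: dir_deriv_def fibre_app_def differential_def vector_fields_def)
    then have "dir_deriv (anchor A \<pi> \<xi> \<odot> \<alpha>) f
        = \<pi> \<odot> \<alpha> \<odot> differential A f + (\<alpha> \<odot> \<xi>) * dir_deriv \<xi> f" by blast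
    moreover have "\<pi> \<odot> \<alpha> \<odot> differential A f \<in> smooth_funs A"
      using \<pi> \<alpha> differential_one_form[OF M f] by (simp add: bivector_field_def)
    moreover have "\<alpha> \<odot> \<xi> \<in> smooth_funs A" "dir_deriv \<xi> f \<in> smooth_funs A"
      using \<alpha> \<xi> f by (auto simp: one_forms_def vector_fields_def)
    ultimately show ?thesis using M by (simp add: smooth_funs_add smooth_funs_mult)
  qed
  then show ?thesis using T by (simp add: vector_fields_def)
qed

lemma metric:
  assumes "pseudo_riemannian_metric A g" and "v \<in> tangent_space A p"
  shows metric_lin: "lin_on (tangent_space A p) (g p v)"
    and metric_lin_left: "lin_on (tangent_space A p) (\<lambda>u. g p u v)"
    and metric_sym: "w \<in> tangent_space A p \<Longrightarrow> g p v w = g p w v"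
    and metric_nondegenerate: "(\<And>w. w \<in> tangent_space A p \<Longrightarrow> g p v w = 0) \<Longrightarrow> v = 0"
  using assms unfolding pseudo_riemannian_metric_def bilin_on_def by blast+

lemma flat_cotangent:
  assumes "smooth_manifold A" "pseudo_riemannian_metric A g" "v \<in> tangent_space A p"
  shows "flat A g p v \<in> cotangent_space A p"
  using metric_lin[OF assms(2,3)] subspace_tangent_space[OF assms(1), of p]
  by (auto simp: cotangent_space_def flat_def lin_on_def subspace_add subspace_scale)

lemma flat_linear:
  assumes g: "pseudo_riemannian_metric A g" and u: "u \<in> tangent_space A p"
  shows flat_add: "v \<in> tangent_space A p \<Longrightarrow> flat A g p (u + v) = flat A g p u + flat A g p v"
    and flat_scale: "flat A g p (k *\<^sub>R u) = k *\<^sub>R flat A g p u"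
proof -
  have lin: "lin_on (tangent_space A p) (\<lambda>u. g p u w)" if "w \<in> tangent_space A p" for w
    by (rule metric_lin_left[OF g that])
  show "flat A g p (u + v) = flat A g p u + flat A g p v"
    if v: "v \<in> tangent_space A p"
    using lin_onD_add[OF lin u v] by (auto simp: flat_def fun_eq_iff)
  show "flat A g p (k *\<^sub>R u) = k *\<^sub>R flat A g p u"
    using lin_onD_scale[OF lin u] by (auto simp: flat_def fun_eq_iff)
qed

lemma sharp_flat:
  assumes M: "smooth_manifold A" and g: "pseudo_riemannian_metric A g"
    and v: "v \<in> tangent_space A p"
  shows "sharp_g A g p (flat A g p v) = v"
proof -
  have "inj_on (flat A g p) (tangent_space A p)"
  proof (rule inj_onI)
    fix x y assume xy: "x \<in> tangent_space A p" "y \<in> tangent_space A p"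
      and eq: "flat A g p x = flat A g p y"
    have "g p (x - y) w = 0" if w: "w \<in> tangent_space A p" for w
      using lin_onD_diff[OF metric_lin_left[OF g w] subspace_tangent_space[OF M] xy]
        fun_cong[OF eq, of w] w by (simp add: flat_def)
    then have "x - y = 0"
      using metric_nondegenerate[OF g, of "x - y" p] xy subspace_tangent_space[OF M, of p]
      by (simp add: subspace_diff)
    then show "x = y" by simp
  qed
  then show ?thesis unfolding sharp_g_def using v by (rule the_inv_into_f_f)
qed

text \<open>The isometry condition descends from global one-forms to the single fibres, because
  differentials realise all covectors.\<close>
lemma isometric_anchor_at:
  assumes M: "smooth_manifold A" and iso: "isometric_anchor A \<rho> g"
    and a: "a \<in> cotangent_space A p" and b: "b \<in> cotangent_space A p"
  shows "g p (\<rho> p a) (\<rho> p b) = cometric A g p a b"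
proof -
  obtain f where f: "f \<in> smooth_funs A" "differential A f p = a"
    using covector_is_differential[OF M a] .
  obtain h where h: "h \<in> smooth_funs A" "differential A h p = b"
    using covector_is_differential[OF M b] .
  have "(g \<odot> (\<rho> \<odot> differential A f) \<odot> (\<rho> \<odot> differential A h)) p
      = (cometric A g \<odot> differential A f \<odot> differential A h) p"
    using iso differential_one_form[OF M f(1)] differential_one_form[OF M h(1)]
    by (simp add: isometric_anchor_def)
  then show ?thesis using f h by (simp add: fibre_app_def)
qed

text \<open>The composition \<open>\<rho> \<circ> flat\<close> is an endomorphism of \<open>T\<^sub>pM\<close> which preserves \<open>g\<close>. Since \<open>g\<close> is
  nondegenerate, it has trivial kernel, and then it is onto by dimension.\<close>
lemma isometric_anchor_surjective:
  assumes M: "smooth_manifold A" and \<pi>: "bivector_field A \<pi>" and \<xi>: "\<xi> \<in> vector_fields A"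
    and g: "pseudo_riemannian_metric A g" and iso: "isometric_anchor A (anchor A \<pi> \<xi>) g"
    and u: "u \<in> tangent_space A p"
  obtains a where "a \<in> cotangent_space A p" "anchor A \<pi> \<xi> p a = u"
proof -
  obtain B where B: "finite B" "independent B" "span B = tangent_space A p"
    using tangent_space_basis[OF M] .
  let ?F = "\<lambda>v. anchor A \<pi> \<xi> p (flat A g p v)"
  note fl = flat_cotangent[OF M g]
  note subT = subspace_tangent_space[OF M, of p]
  have isoF: "g p (?F v) (?F w) = g p v w"
    if "v \<in> tangent_space A p" "w \<in> tangent_space A p" for v w
    using isometric_anchor_at[OF M iso fl[OF that(1)] fl[OF that(2)]] that sharp_flat[OF M g]
    by (simp add: cometric_def)
  have "?F ` span B = span B"
  proof (rule injective_endomorphism_surjective[OF B(1,2)], unfold B(3))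
    show "?F v \<in> tangent_space A p" if "v \<in> tangent_space A p" for v
      by (rule anchor_tangent[OF M \<pi> \<xi> fl[OF that]])
    show "?F (v + w) = ?F v + ?F w" if "v \<in> tangent_space A p" "w \<in> tangent_space A p" for v w
      by (simp only: flat_add[OF g that] anchor_add[OF M \<pi> \<xi> fl[OF that(1)] fl[OF that(2)]])
    show "?F (k *\<^sub>R v) = k *\<^sub>R ?F v" if "v \<in> tangent_space A p" for k v
      by (simp only: flat_scale[OF g that] anchor_scale[OF M \<pi> \<xi> fl[OF that]])
    show "v = 0" if v: "v \<in> tangent_space A p" and F0: "?F v = 0" for v
    proof (rule metric_nondegenerate[OF g v])
      fix w assume w: "w \<in> tangent_space A p"
      have "g p v w = g p 0 (?F w)" using isoF[OF v w] F0 by simp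
      also have "\<dots> = 0"
        using lin_onD_zero[OF metric_lin_left[OF g anchor_tangent[OF M \<pi> \<xi> fl[OF w]]] subT] .
      finally show "g p v w = 0" .
    qed
  qed
  then have "u \<in> ?F ` tangent_space A p" using u B(3) by simp
  then obtain v where v: "v \<in> tangent_space A p" "?F v = u" by blast
  show ?thesis by (rule that[OF fl[OF v(1)] v(2)])
qed


section \<open>Comparison of the two Levi-Civita derivatives\<close>

text \<open>The braid argument: alternating the two transpositions six times returns to the start,
  and the three skew steps produce the sign \<open>-1\<close>.\<close>
lemma symmetric_skew_zero:
  fixes T :: "'a \<Rightarrow> 'a \<Rightarrow> 'a \<Rightarrow> real"
  assumes sym: "\<And>a b c. a \<in> S \<Longrightarrow> b \<in> S \<Longrightarrow> c \<in> S \<Longrightarrow> T a b c = T b a c"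
    and skew: "\<And>a b c. a \<in> S \<Longrightarrow> b \<in> S \<Longrightarrow> c \<in> S \<Longrightarrow> T a b c = - T a c b"
    and S: "a \<in> S" "b \<in> S" "c \<in> S"
  shows "T a b c = 0"
proof -
  have "T a b c = - T a c b" "T a c b = T c a b" "T c a b = - T c b a"
    "T c b a = T b c a" "T b c a = - T b a c" "T b a c = T a b c"
    using sym skew S by blast+
  then show ?thesis by linarith
qed

theorem proposition2p1:
  fixes A :: "('m::{t2_space, second_countable_topology}, 'e::real_normed_vector) chart set"
    and \<pi> :: "'m \<Rightarrow> 'm covec \<Rightarrow> 'm covec \<Rightarrow> real"
    and \<xi> :: "'m \<Rightarrow> 'm tvec"
    and g :: "'m \<Rightarrow> 'm tvec \<Rightarrow> 'm tvec \<Rightarrow> real"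
    and D :: "('m \<Rightarrow> 'm covec) \<Rightarrow> ('m \<Rightarrow> 'm covec) \<Rightarrow> 'm \<Rightarrow> 'm covec"
    and N :: "('m \<Rightarrow> 'm tvec) \<Rightarrow> ('m \<Rightarrow> 'm tvec) \<Rightarrow> 'm \<Rightarrow> 'm tvec"
  assumes "smooth_manifold A"
    and "bivector_field A \<pi>"
    and "\<xi> \<in> vector_fields A"
    and "pseudo_riemannian_metric A g"
    and "pre_lie_algebroid A (anchor A \<pi> \<xi>) (bracket_g A \<pi> \<xi> g)"
    and "isometric_anchor A (anchor A \<pi> \<xi>) g"
    and "contravariant_levi_civita A \<pi> \<xi> g D"
    and "levi_civita_connection A g N"
  shows "\<forall>\<alpha>\<in>one_forms A. \<forall>\<beta>\<in>one_forms A.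
    anchor A \<pi> \<xi> \<odot> D \<alpha> \<beta> = N (anchor A \<pi> \<xi> \<odot> \<alpha>) (anchor A \<pi> \<xi> \<odot> \<beta>)"
proof (intro ballI ext)
  note M = assms(1) and \<pi> = assms(2) and \<xi> = assms(3) and g = assms(4)
  let ?\<rho> = "\<lambda>\<alpha>. anchor A \<pi> \<xi> \<odot> \<alpha>"
  have isom: "cometric A g \<odot> \<beta> \<odot> \<gamma> = g \<odot> ?\<rho> \<beta> \<odot> ?\<rho> \<gamma>"
    if "\<beta> \<in> one_forms A" "\<gamma> \<in> one_forms A" for \<beta> \<gamma>
    using assms(6) that by (simp add: isometric_anchor_def)
  have \<rho>V: "?\<rho> \<alpha> \<in> vector_fields A" if "\<alpha> \<in> one_forms A" for \<alpha>
    by (rule anchor_vector_field[OF M \<pi> \<xi> that])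
  have D1: "D \<alpha> \<beta> \<in> one_forms A"
    and Dtor: "D \<alpha> \<beta> - D \<beta> \<alpha> = bracket_g A \<pi> \<xi> g \<alpha> \<beta>"
    if "\<alpha> \<in> one_forms A" "\<beta> \<in> one_forms A" for \<alpha> \<beta>
    using assms(7) that
    by (auto simp: contravariant_levi_civita_def levi_civita_on_def derivative_on_def)
  have Dmet: "dir_deriv (?\<rho> \<alpha>) (cometric A g \<odot> \<beta> \<odot> \<gamma>)
      = cometric A g \<odot> D \<alpha> \<beta> \<odot> \<gamma> + cometric A g \<odot> \<beta> \<odot> D \<alpha> \<gamma>"
    if "\<alpha> \<in> one_forms A" "\<beta> \<in> one_forms A" "\<gamma> \<in> one_forms A" for \<alpha> \<beta> \<gamma>
    using assms(7) that by (auto simp: contravariant_levi_civita_def levi_civita_on_def)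
  have N1: "N X Y \<in> vector_fields A" and Ntor: "N X Y - N Y X = lie_bracket A X Y"
    if "X \<in> vector_fields A" "Y \<in> vector_fields A" for X Y
    using assms(8) that
    by (auto simp: levi_civita_connection_def levi_civita_on_def derivative_on_def)
  have Nmet: "dir_deriv X (g \<odot> Y \<odot> Z) = g \<odot> N X Y \<odot> Z + g \<odot> Y \<odot> N X Z"
    if "X \<in> vector_fields A" "Y \<in> vector_fields A" "Z \<in> vector_fields A" for X Y Z
    using assms(8) that by (auto simp: levi_civita_connection_def levi_civita_on_def)
  fix \<alpha> \<beta> p f
  assume \<alpha>: "\<alpha> \<in> one_forms A" and \<beta>: "\<beta> \<in> one_forms A"
  note subT = subspace_tangent_space[OF M, of p]
  have tan: "X p \<in> tangent_space A p" if "X \<in> vector_fields A" for X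
    using that by (simp add: vector_fields_def)
  define E where "E \<alpha> \<beta> = ?\<rho> (D \<alpha> \<beta>) p - N (?\<rho> \<alpha>) (?\<rho> \<beta>) p" for \<alpha> \<beta>
  define T where "T \<alpha> \<beta> \<gamma> = g p (E \<alpha> \<beta>) (?\<rho> \<gamma> p)" for \<alpha> \<beta> \<gamma>
  have ET: "E \<alpha> \<beta> \<in> tangent_space A p" if "\<alpha> \<in> one_forms A" "\<beta> \<in> one_forms A" for \<alpha> \<beta>
    unfolding E_def by (intro subspace_diff[OF subT] tan \<rho>V D1 N1 that)
  have "E \<alpha> \<beta> = E \<beta> \<alpha>" if a: "\<alpha> \<in> one_forms A" and b: "\<beta> \<in> one_forms A" for \<alpha> \<beta>
  proof -
    have "anchor A \<pi> \<xi> p (D \<alpha> \<beta> p) = anchor A \<pi> \<xi> p ((D \<alpha> \<beta> - D \<beta> \<alpha>) p + D \<beta> \<alpha> p)"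
      by simp
    also have "\<dots> = anchor A \<pi> \<xi> p ((D \<alpha> \<beta> - D \<beta> \<alpha>) p) + anchor A \<pi> \<xi> p (D \<beta> \<alpha> p)"
      using one_form_at[OF D1[OF a b], of p] one_form_at[OF D1[OF b a], of p]
        subspace_cotangent_space[OF M, of p]
      by (intro anchor_add[OF M \<pi> \<xi>]) (auto simp: subspace_diff)
    finally have "?\<rho> (D \<alpha> \<beta>) p - ?\<rho> (D \<beta> \<alpha>) p = ?\<rho> (bracket_g A \<pi> \<xi> g \<alpha> \<beta>) p"
      using Dtor[OF a b] by (simp add: fibre_app_def)
    also have "\<dots> = lie_bracket A (?\<rho> \<alpha>) (?\<rho> \<beta>) p"
      using assms(5) a b by (simp add: pre_lie_algebroid_def)
    also have "\<dots> = N (?\<rho> \<alpha>) (?\<rho> \<beta>) p - N (?\<rho> \<beta>) (?\<rho> \<alpha>) p"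
      by (simp flip: Ntor[OF \<rho>V[OF a] \<rho>V[OF b]])
    finally show ?thesis by (simp add: E_def algebra_simps)
  qed
  then have sym: "T \<alpha> \<beta> \<gamma> = T \<beta> \<alpha> \<gamma>" if "\<alpha> \<in> one_forms A" "\<beta> \<in> one_forms A" for \<alpha> \<beta> \<gamma>
    using that by (simp add: T_def)
  have skew: "T \<alpha> \<beta> \<gamma> = - T \<alpha> \<gamma> \<beta>"
    if a: "\<alpha> \<in> one_forms A" and b: "\<beta> \<in> one_forms A" and c: "\<gamma> \<in> one_forms A" for \<alpha> \<beta> \<gamma>
  proof -
    have Tdiff: "T \<alpha> \<beta> \<gamma> = g p (?\<rho> (D \<alpha> \<beta>) p) (?\<rho> \<gamma> p) - g p (N (?\<rho> \<alpha>) (?\<rho> \<beta>) p) (?\<rho> \<gamma> p)"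
      if "\<beta> \<in> one_forms A" "\<gamma> \<in> one_forms A" for \<beta> \<gamma>
      unfolding T_def E_def
      by (rule lin_onD_diff[OF metric_lin_left[OF g] subT])
        (intro tan \<rho>V D1 N1 a that)+
    \<comment> \<open>Both sides are the derivative of \<open>g(\<rho> \<beta>, \<rho> \<gamma>)\<close> along \<open>\<rho> \<alpha>\<close>.\<close>
    have "(g \<odot> ?\<rho> (D \<alpha> \<beta>) \<odot> ?\<rho> \<gamma> + g \<odot> ?\<rho> \<beta> \<odot> ?\<rho> (D \<alpha> \<gamma>)) p
        = (g \<odot> N (?\<rho> \<alpha>) (?\<rho> \<beta>) \<odot> ?\<rho> \<gamma> + g \<odot> ?\<rho> \<beta> \<odot> N (?\<rho> \<alpha>) (?\<rho> \<gamma>)) p"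
      using Dmet[OF a b c] Nmet[OF \<rho>V[OF a] \<rho>V[OF b] \<rho>V[OF c]] a b c by (simp add: isom D1)
    then have "g p (?\<rho> (D \<alpha> \<beta>) p) (?\<rho> \<gamma> p) + g p (?\<rho> \<beta> p) (?\<rho> (D \<alpha> \<gamma>) p)
        = g p (N (?\<rho> \<alpha>) (?\<rho> \<beta>) p) (?\<rho> \<gamma> p) + g p (?\<rho> \<beta> p) (N (?\<rho> \<alpha>) (?\<rho> \<gamma>) p)"
      by (simp add: fibre_app_def)
    moreover have "g p (?\<rho> \<beta> p) (X p) = g p (X p) (?\<rho> \<beta> p)" if "X \<in> vector_fields A" for X
      by (rule metric_sym[OF g tan[OF \<rho>V[OF b]] tan[OF that]])
    ultimately show ?thesis
      using Tdiff[OF b c] Tdiff[OF c b] \<rho>V[OF D1[OF a c]] N1[OF \<rho>V[OF a] \<rho>V[OF c]] by simp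
  qed
  have T0: "T \<alpha> \<beta> \<gamma> = 0" if "\<gamma> \<in> one_forms A" for \<gamma>
    by (rule symmetric_skew_zero[of "one_forms A" T, OF sym skew \<alpha> \<beta> that])
  have "E \<alpha> \<beta> = 0"
  proof (rule metric_nondegenerate[OF g ET[OF \<alpha> \<beta>]])
    fix w assume "w \<in> tangent_space A p"
    then obtain a where a: "a \<in> cotangent_space A p" "anchor A \<pi> \<xi> p a = w"
      by (rule isometric_anchor_surjective[OF M \<pi> \<xi> g assms(6)])
    obtain h where h: "h \<in> smooth_funs A" "differential A h p = a"
      using covector_is_differential[OF M a(1)] .
    show "g p (E \<alpha> \<beta>) w = 0"
      using T0[OF differential_one_form[OF M h(1)]] a h by (simp add: T_def fibre_app_def)
  qed
  then show "?\<rho> (D \<alpha> \<beta>) p f = N (?\<rho> \<alpha>) (?\<rho> \<beta>) p f"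
    by (simp add: E_def)
qed

end
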